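(* Let $\mathcal{A}$ and $\mathcal{B}$ be categories and let $G:\mathcal{A}\to\mathcal{B}$, $L:\mathcal{B}\to\mathcal{A}$ be functors with $L$ left adjoint to $G$, forming a reflection (that is, the counit $\epsilon:L\circ G\to 1_{\mathcal{A}}$ is an isomorphism). Then this reflection arises from the general construction described in the context: there exist data $(\mathcal{H},\mathcal{K},\mathcal{U},I,J,R,S,\xi,\chi,Z,W,\epsilon',\eta')$ satisfying conditions (1)–(4) of the context, with $\mathcal{H}=\mathcal{A}$ and $\mathcal{K}=\mathcal{B}$, together with isomorphisms of categories $\Phi:\tilde{R}\to\mathcal{A}$ and $\Psi:\tilde{S}\to\mathcal{B}$ under which $\tilde{Z}$ corresponds to $G$ and $\tilde{W}$ corresponds to $L$, i.e. $\Psi\circ\tilde{Z}=G\circ\Phi$ and $\Phi\circ\tilde{W}=L\circ\Psi$.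
   Context: **Data.** $\mathcal{H},\mathcal{K},\mathcal{U}$ are categories; $I:\mathcal{H}\to\mathcal{U}$ and $J:\mathcal{K}\to\mathcal{U}$ are (covariant) functors; $R,S\subseteq \mathrm{Ob}(\mathcal{H})\times \mathrm{Ob}(\mathcal{K})$ are two binary relations. For every $(C,D)\in R$ there is given an arrow $\xi_{(C,D)}:I(C)\to J(D)$ in $\mathcal{U}$, and for every $(C,D)\in S$ an arrow $\chi_{(C,D)}:J(D)\to I(C)$ in $\mathcal{U}$. There are given functions $Z:R\to S$ and $W:S\to R$ such that $Z$ keeps the second component fixed and $W$ keeps the first component fixed. Write $\pi^{\mathcal{H}}_S$ for the first projection $S\to\mathrm{Ob}(\mathcal{H})$ and $\pi^{\mathcal{K}}_R$ for the second projection $R\to\mathrm{Ob}(\mathcal{K})$. Thus $Z(C,D)=(\pi^{\mathcal{H}}_S(Z(C,D)),D)$ for $(C,D)\in R$, and $W(C,D)=(C,\pi^{\mathcal{K}}_R(W(C,D)))$ for $(C,D)\in S$. **Conditions.** (1) For every $(C,D)\in R$ there is a chosen isomorphism $\epsilon'_{(C,D)}:\pi^{\mathcal{H}}_S(Z(C,D))\to C$ in $\mathcal{H}$ such that $\chi_{Z(C,D)}\circ\xi_{(C,D)}=I\big((\epsilon'_{(C,D)})^{-1}\big)$. (2) For every $(C,D)\in S$ there is a chosen morphism $\eta'_{(C,D)}:D\to\pi^{\mathcal{K}}_R(W(C,D))$ in $\mathcal{K}$ such that $\xi_{W(C,D)}\circ\chi_{(C,D)}=J(\eta'_{(C,D)})$.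 (3) For every $(C,D)\in R$, the arrow $\xi_{(C,D)}:I(C)\to J(D)$ is an isomorphism in $\mathcal{U}$. (4) For every $(C,D)\in R$, the morphism $\eta'_{Z(C,D)}$ is an isomorphism in $\mathcal{K}$. **The category $\tilde{R}$.** Objects are the elements of $R$. Arrows $(C,D)\to(C',D')$ are pairs $(u,v)$ with $u:C\to C'$ in $\mathcal{H}$ and $v:D\to D'$ in $\mathcal{K}$ such that $\xi_{(C',D')}\circ I(u)=J(v)\circ\xi_{(C,D)}$. Composition is componentwise. **The category $\tilde{S}$.** Objects are the elements of $S$. Arrows $(C,D)\to(C',D')$ are triples $(z,v,w)$ with $z:C\to C'$ in $\mathcal{H}$, $v:D\to D'$ in $\mathcal{K}$ and $w:\pi^{\mathcal{K}}_R(W(C,D))\to\pi^{\mathcal{K}}_R(W(C',D'))$ in $\mathcal{K}$ such that $\chi_{(C',D')}\circ J(v)=I(z)\circ\chi_{(C,D)}$ and $\xi_{W(C',D')}\circ I(z)=J(w)\circ\xi_{W(C,D)}$. Composition is componentwise. **The functor $\tilde{Z}:\tilde{R}\to\tilde{S}$.** On objects $\tilde{Z}(C,D)=Z(C,D)$. On an arrow $(u,v):(C,D)\to(C',D')$ it is $\tilde{Z}(u,v)=(z,v,w)$, where $z=(\epsilon'_{(C',D')})^{-1}\circ u\circ\epsilon'_{(C,D)}$ and $w$ is the unique arrow of $\mathcal{K}$ with $w\circ\eta'_{Z(C,D)}=\eta'_{Z(C',D')}\circ v$. **The functor $\tilde{W}:\tilde{S}\to\tilde{R}$.** On objects $\tilde{W}(C,D)=W(C,D)$;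 on arrows $\tilde{W}(z,v,w)=(z,w)$. *)

theory Defs
  imports Main
begin

section \<open>Categories, functors, natural transformations\<close>

record ('o, 'm) cat =
  Obj  :: "'o set"
  Arr  :: "'m set"
  Dom  :: "'m \<Rightarrow> 'o"
  Cod  :: "'m \<Rightarrow> 'o"
  Id   :: "'o \<Rightarrow> 'm"
  Comp :: "'m \<Rightarrow> 'm \<Rightarrow> 'm"    (* Comp C g f is "g after f" *)

definition hom :: "('o, 'm) cat \<Rightarrow> 'o \<Rightarrow> 'o \<Rightarrow> 'm set" where
  "hom C a b = {f \<in> Arr C. Dom C f = a \<and> Cod C f = b}"

locale category =
  fixes C :: "('o, 'm) cat"
  assumes Dom_Obj: "f \<in> Arr C \<Longrightarrow> Dom C f \<in> Obj C"
    and Cod_Obj: "f \<in> Arr C \<Longrightarrow> Cod C f \<in> Obj C"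
    and Id_hom: "a \<in> Obj C \<Longrightarrow> Id C a \<in> hom C a a"
    and Comp_hom: "f \<in> hom C a b \<Longrightarrow> g \<in> hom C b c \<Longrightarrow> Comp C g f \<in> hom C a c"
    and Comp_Id: "f \<in> hom C a b \<Longrightarrow> Comp C f (Id C a) = f"
    and Id_Comp: "f \<in> hom C a b \<Longrightarrow> Comp C (Id C b) f = f"
    and Comp_assoc: "f \<in> hom C a b \<Longrightarrow> g \<in> hom C b c \<Longrightarrow> h \<in> hom C c d \<Longrightarrow>
      Comp C (Comp C h g) f = Comp C h (Comp C g f)"

definition inverse_arrows :: "('o, 'm) cat \<Rightarrow> 'm \<Rightarrow> 'm \<Rightarrow> bool" where
  "inverse_arrows C f g \<longleftrightarrow>
     f \<in> Arr C \<and> g \<in> hom C (Cod C f) (Dom C f) \<and>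
     Comp C g f = Id C (Dom C f) \<and> Comp C f g = Id C (Cod C f)"

definition iso :: "('o, 'm) cat \<Rightarrow> 'm \<Rightarrow> bool" where
  "iso C f \<longleftrightarrow> (\<exists>g. inverse_arrows C f g)"

definition inv_arr :: "('o, 'm) cat \<Rightarrow> 'm \<Rightarrow> 'm" where
  "inv_arr C f = (THE g. inverse_arrows C f g)"

record ('o, 'm, 'p, 'n) fctr =
  omap :: "'o \<Rightarrow> 'p"
  amap :: "'m \<Rightarrow> 'n"

locale cat_functor = C: category C + D: category D
  for C :: "('o, 'm) cat" and D :: "('p, 'n) cat" +
  fixes F :: "('o, 'm, 'p, 'n) fctr"
  assumes omap_Obj: "a \<in> Obj C \<Longrightarrow> omap F a \<in> Obj D"
    and amap_hom: "f \<in> hom C a b \<Longrightarrow> amap F f \<in> hom D (omap F a) (omap F b)"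
    and amap_Id: "a \<in> Obj C \<Longrightarrow> amap F (Id C a) = Id D (omap F a)"
    and amap_Comp: "f \<in> hom C a b \<Longrightarrow> g \<in> hom C b c \<Longrightarrow>
      amap F (Comp C g f) = Comp D (amap F g) (amap F f)"

definition id_functor :: "('o, 'm, 'o, 'm) fctr" where
  "id_functor = \<lparr>omap = (\<lambda>a. a), amap = (\<lambda>f. f)\<rparr>"

definition comp_functor ::
  "('p, 'n, 'q, 'k) fctr \<Rightarrow> ('o, 'm, 'p, 'n) fctr \<Rightarrow> ('o, 'm, 'q, 'k) fctr" (infixr "\<circ>\<^sub>F" 55) where
  "G \<circ>\<^sub>F F = \<lparr>omap = (\<lambda>a. omap G (omap F a)), amap = (\<lambda>f. amap G (amap F f))\<rparr>"

(* Equality of functors out of C; the values outside the carriers are irrelevant. *)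
definition functor_eq :: "('o, 'm) cat \<Rightarrow> ('o, 'm, 'p, 'n) fctr \<Rightarrow> ('o, 'm, 'p, 'n) fctr \<Rightarrow> bool" where
  "functor_eq C F G \<longleftrightarrow>
     (\<forall>a\<in>Obj C. omap F a = omap G a) \<and> (\<forall>f\<in>Arr C. amap F f = amap G f)"

definition cat_isomorphism :: "('o, 'm) cat \<Rightarrow> ('p, 'n) cat \<Rightarrow> ('o, 'm, 'p, 'n) fctr \<Rightarrow> bool" where
  "cat_isomorphism C D F \<longleftrightarrow> cat_functor C D F \<and>
     (\<exists>F'. cat_functor D C F' \<and> functor_eq C (F' \<circ>\<^sub>F F) id_functor \<and> functor_eq D (F \<circ>\<^sub>F F') id_functor)"

locale nat_trans = F: cat_functor C D F + G: cat_functor C D G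
  for C :: "('o, 'm) cat" and D :: "('p, 'n) cat"
    and F :: "('o, 'm, 'p, 'n) fctr" and G :: "('o, 'm, 'p, 'n) fctr" +
  fixes \<tau> :: "'o \<Rightarrow> 'n"
  assumes component_hom: "a \<in> Obj C \<Longrightarrow> \<tau> a \<in> hom D (omap F a) (omap G a)"
    and naturality: "f \<in> hom C a b \<Longrightarrow> Comp D (\<tau> b) (amap F f) = Comp D (amap G f) (\<tau> a)"

section \<open>Adjunctions and reflections\<close>

(* L is left adjoint to G, with unit \<eta> and counit \<epsilon>. *)
locale adjunction =
  G: cat_functor A B G + L: cat_functor B A L +
  unit: nat_trans B B id_functor "G \<circ>\<^sub>F L" \<eta> +
  counit: nat_trans A A "L \<circ>\<^sub>F G" id_functor \<epsilon>
  for A :: "('a, 'm) cat" and B :: "('b, 'n) cat"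
    and G :: "('a, 'm, 'b, 'n) fctr" and L :: "('b, 'n, 'a, 'm) fctr"
    and \<eta> :: "'b \<Rightarrow> 'n" and \<epsilon> :: "'a \<Rightarrow> 'm" +
  assumes triangle_L: "b \<in> Obj B \<Longrightarrow>
      Comp A (\<epsilon> (omap L b)) (amap L (\<eta> b)) = Id A (omap L b)"
    and triangle_G: "a \<in> Obj A \<Longrightarrow>
      Comp B (amap G (\<epsilon> a)) (\<eta> (omap G a)) = Id B (omap G a)"

locale reflection = adjunction +
  assumes counit_iso: "a \<in> Obj A \<Longrightarrow> iso A (\<epsilon> a)"

section \<open>The general construction\<close>

locale relational_data =
  I: cat_functor H U I + J: cat_functor K U J
  for H :: "('a, 'm) cat" and K :: "('b, 'n) cat" and U :: "('c, 'k) cat"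
    and I :: "('a, 'm, 'c, 'k) fctr" and J :: "('b, 'n, 'c, 'k) fctr" +
  fixes R S :: "('a \<times> 'b) set"
    and \<xi> \<chi> :: "'a \<times> 'b \<Rightarrow> 'k"
    and Z W :: "'a \<times> 'b \<Rightarrow> 'a \<times> 'b"
  assumes R_sub: "R \<subseteq> Obj H \<times> Obj K"
    and S_sub: "S \<subseteq> Obj H \<times> Obj K"
    and \<xi>_hom: "(c, d) \<in> R \<Longrightarrow> \<xi> (c, d) \<in> hom U (omap I c) (omap J d)"
    and \<chi>_hom: "(c, d) \<in> S \<Longrightarrow> \<chi> (c, d) \<in> hom U (omap J d) (omap I c)"
    and Z_S: "p \<in> R \<Longrightarrow> Z p \<in> S" and snd_Z: "p \<in> R \<Longrightarrow> snd (Z p) = snd p"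
    and W_R: "p \<in> S \<Longrightarrow> W p \<in> R" and fst_W: "p \<in> S \<Longrightarrow> fst (W p) = fst p"

locale relational_reflection_data =
  relational_data H K U I J R S \<xi> \<chi> Z W
  for H :: "('a, 'm) cat" and K :: "('b, 'n) cat" and U :: "('c, 'k) cat"
    and I :: "('a, 'm, 'c, 'k) fctr" and J :: "('b, 'n, 'c, 'k) fctr"
    and R S :: "('a \<times> 'b) set"
    and \<xi> \<chi> :: "'a \<times> 'b \<Rightarrow> 'k"
    and Z W :: "'a \<times> 'b \<Rightarrow> 'a \<times> 'b" +
  fixes \<epsilon>' :: "'a \<times> 'b \<Rightarrow> 'm" and \<eta>' :: "'a \<times> 'b \<Rightarrow> 'n"
  assumes \<epsilon>'_hom: "(c, d) \<in> R \<Longrightarrow> \<epsilon>' (c, d) \<in> hom H (fst (Z (c, d))) c"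
    and \<epsilon>'_iso: "(c, d) \<in> R \<Longrightarrow> iso H (\<epsilon>' (c, d))"
    and \<chi>_\<xi>: "(c, d) \<in> R \<Longrightarrow>
      Comp U (\<chi> (Z (c, d))) (\<xi> (c, d)) = amap I (inv_arr H (\<epsilon>' (c, d)))"
    and \<eta>'_hom: "(c, d) \<in> S \<Longrightarrow> \<eta>' (c, d) \<in> hom K d (snd (W (c, d)))"
    and \<xi>_\<chi>: "(c, d) \<in> S \<Longrightarrow>
      Comp U (\<xi> (W (c, d))) (\<chi> (c, d)) = amap J (\<eta>' (c, d))"
    and \<xi>_iso: "(c, d) \<in> R \<Longrightarrow> iso U (\<xi> (c, d))"
    and \<eta>'_Z_iso: "(c, d) \<in> R \<Longrightarrow> iso K (\<eta>' (Z (c, d)))"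

(* Domains and codomains in R~ and S~ can be read off componentwise, so the arrows
   are untagged pairs and triples. *)
definition R_tilde ::
  "('a, 'm) cat \<Rightarrow> ('b, 'n) cat \<Rightarrow> ('c, 'k) cat \<Rightarrow> ('a, 'm, 'c, 'k) fctr \<Rightarrow> ('b, 'n, 'c, 'k) fctr \<Rightarrow>
   ('a \<times> 'b) set \<Rightarrow> ('a \<times> 'b \<Rightarrow> 'k) \<Rightarrow> ('a \<times> 'b, 'm \<times> 'n) cat" where
  "R_tilde H K U I J R \<xi> =
    \<lparr>Obj = R,
     Arr = {(u, v). \<exists>c d c' d'. (c, d) \<in> R \<and> (c', d') \<in> R \<and> u \<in> hom H c c' \<and> v \<in> hom K d d' \<and>
              Comp U (\<xi> (c', d')) (amap I u) = Comp U (amap J v) (\<xi> (c, d))},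
     Dom = (\<lambda>(u, v). (Dom H u, Dom K v)),
     Cod = (\<lambda>(u, v). (Cod H u, Cod K v)),
     Id = (\<lambda>(c, d). (Id H c, Id K d)),
     Comp = (\<lambda>(u', v') (u, v). (Comp H u' u, Comp K v' v))\<rparr>"

definition S_tilde ::
  "('a, 'm) cat \<Rightarrow> ('b, 'n) cat \<Rightarrow> ('c, 'k) cat \<Rightarrow> ('a, 'm, 'c, 'k) fctr \<Rightarrow> ('b, 'n, 'c, 'k) fctr \<Rightarrow>
   ('a \<times> 'b) set \<Rightarrow> ('a \<times> 'b \<Rightarrow> 'k) \<Rightarrow> ('a \<times> 'b \<Rightarrow> 'k) \<Rightarrow> ('a \<times> 'b \<Rightarrow> 'a \<times> 'b) \<Rightarrow>
   ('a \<times> 'b, 'm \<times> 'n \<times> 'n) cat" where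
  "S_tilde H K U I J S \<xi> \<chi> W =
    \<lparr>Obj = S,
     Arr = {(z, v, w). \<exists>c d c' d'. (c, d) \<in> S \<and> (c', d') \<in> S \<and>
              z \<in> hom H c c' \<and> v \<in> hom K d d' \<and> w \<in> hom K (snd (W (c, d))) (snd (W (c', d'))) \<and>
              Comp U (\<chi> (c', d')) (amap J v) = Comp U (amap I z) (\<chi> (c, d)) \<and>
              Comp U (\<xi> (W (c', d'))) (amap I z) = Comp U (amap J w) (\<xi> (W (c, d)))},
     Dom = (\<lambda>(z, v, w). (Dom H z, Dom K v)),
     Cod = (\<lambda>(z, v, w). (Cod H z, Cod K v)),
     Id = (\<lambda>(c, d). (Id H c, Id K d, Id K (snd (W (c, d))))),
     Comp = (\<lambda>(z', v', w') (z, v, w). (Comp H z' z, Comp K v' v, Comp K w' w))\<rparr>"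

definition Z_tilde ::
  "('a, 'm) cat \<Rightarrow> ('b, 'n) cat \<Rightarrow> ('a \<times> 'b \<Rightarrow> 'a \<times> 'b) \<Rightarrow> ('a \<times> 'b \<Rightarrow> 'a \<times> 'b) \<Rightarrow>
   ('a \<times> 'b \<Rightarrow> 'm) \<Rightarrow> ('a \<times> 'b \<Rightarrow> 'n) \<Rightarrow> ('a \<times> 'b, 'm \<times> 'n, 'a \<times> 'b, 'm \<times> 'n \<times> 'n) fctr" where
  "Z_tilde H K Z W \<epsilon>' \<eta>' =
    \<lparr>omap = Z,
     amap = (\<lambda>(u, v).
       let p = (Dom H u, Dom K v); p' = (Cod H u, Cod K v) in
         (Comp H (inv_arr H (\<epsilon>' p')) (Comp H u (\<epsilon>' p)),
          v,
          THE w. w \<in> hom K (snd (W (Z p))) (snd (W (Z p'))) \<and>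
                 Comp K w (\<eta>' (Z p)) = Comp K (\<eta>' (Z p')) v))\<rparr>"

definition W_tilde ::
  "('a \<times> 'b \<Rightarrow> 'a \<times> 'b) \<Rightarrow> ('a \<times> 'b, 'm \<times> 'n \<times> 'n, 'a \<times> 'b, 'm \<times> 'n) fctr" where
  "W_tilde W = \<lparr>omap = W, amap = (\<lambda>(z, v, w). (z, w))\<rparr>"


section \<open>Well-definedness of the general construction\<close>

lemma hom_Arr: "f \<in> hom C a b \<Longrightarrow> f \<in> Arr C"
  by (simp add: hom_def)

lemma hom_Dom: "f \<in> hom C a b \<Longrightarrow> Dom C f = a"
  by (simp add: hom_def)

lemma hom_Cod: "f \<in> hom C a b \<Longrightarrow> Cod C f = b"
  by (simp add: hom_def)

context category
begin

lemma inv_arr_inverse: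
  assumes "iso C f"
  shows "inverse_arrows C f (inv_arr C f)"
proof -
  obtain g where g: "inverse_arrows C f g" using assms unfolding iso_def ..
  have "h = g" if h: "inverse_arrows C f h" for h
  proof -
    have f: "f \<in> hom C (Dom C f) (Cod C f)" using h by (simp add: inverse_arrows_def hom_def)
    have gh: "g \<in> hom C (Cod C f) (Dom C f)" "h \<in> hom C (Cod C f) (Dom C f)"
      using g h by (simp_all add: inverse_arrows_def)
    have "h = Comp C (Id C (Dom C f)) h" using Id_Comp[OF gh(2)] by simp
    also have "\<dots> = Comp C (Comp C g f) h" using g by (simp add: inverse_arrows_def)
    also have "\<dots> = Comp C g (Comp C f h)" using Comp_assoc[OF gh(2) f gh(1)] .
    also have "\<dots> = Comp C g (Id C (Cod C f))" using h by (simp add: inverse_arrows_def)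
    also have "\<dots> = g" using Comp_Id[OF gh(1)] .
    finally show ?thesis .
  qed
  then have "inv_arr C f = g" unfolding inv_arr_def by (intro the_equality g)
  then show ?thesis using g by simp
qed

lemma inv_arr:
  assumes "iso C f" "f \<in> hom C a b"
  shows "inv_arr C f \<in> hom C b a" "Comp C (inv_arr C f) f = Id C a" "Comp C f (inv_arr C f) = Id C b"
  using inv_arr_inverse[OF assms(1)] assms(2) by (auto simp: inverse_arrows_def hom_def)

lemma hom_Obj: "f \<in> hom C a b \<Longrightarrow> a \<in> Obj C \<and> b \<in> Obj C"
  using Dom_Obj Cod_Obj by (auto simp: hom_def)

lemma iso_right_cancel:
  assumes "iso C f" "f \<in> hom C a b" "g \<in> hom C b c" "h \<in> hom C b c" "Comp C g f = Comp C h f"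
  shows "g = h"
proof -
  note i = inv_arr[OF assms(1,2)]
  have "g = Comp C (Comp C g f) (inv_arr C f)"
    using Comp_assoc[OF i(1) assms(2,3)] i(3) Comp_Id[OF assms(3)] by simp
  also have "\<dots> = h"
    using Comp_assoc[OF i(1) assms(2,4)] i(3) Comp_Id[OF assms(4)] assms(5) by simp
  finally show ?thesis .
qed

end

context relational_data
begin

abbreviation "RR \<equiv> R_tilde H K U I J R \<xi>"
abbreviation "SS \<equiv> S_tilde H K U I J S \<xi> \<chi> W"

definition sqR where
  "sqR c d c' d' u v \<longleftrightarrow> (c, d) \<in> R \<and> (c', d') \<in> R \<and> u \<in> hom H c c' \<and> v \<in> hom K d d' \<and>
     Comp U (\<xi> (c', d')) (amap I u) = Comp U (amap J v) (\<xi> (c, d))"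

definition sqS where
  "sqS c d c' d' z v w \<longleftrightarrow> (c, d) \<in> S \<and> (c', d') \<in> S \<and>
     z \<in> hom H c c' \<and> v \<in> hom K d d' \<and> w \<in> hom K (snd (W (c, d))) (snd (W (c', d'))) \<and>
     Comp U (\<chi> (c', d')) (amap J v) = Comp U (amap I z) (\<chi> (c, d)) \<and>
     Comp U (\<xi> (W (c', d'))) (amap I z) = Comp U (amap J w) (\<xi> (W (c, d)))"

lemma homR: "f \<in> hom RR p p' \<longleftrightarrow>
    (\<exists>c d c' d' u v. p = (c, d) \<and> p' = (c', d') \<and> f = (u, v) \<and> sqR c d c' d' u v)"
  by (cases p; cases p'; cases f) (auto simp: hom_def R_tilde_def sqR_def)

lemma homS: "f \<in> hom SS p p' \<longleftrightarrow>
    (\<exists>c d c' d' z v w. p = (c, d) \<and> p' = (c', d') \<and> f = (z, v, w) \<and> sqS c d c' d' z v w)"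
  by (cases p; cases p'; cases f) (auto simp: hom_def S_tilde_def sqS_def)

lemma W_pair: "(c, d) \<in> S \<Longrightarrow> (c, snd (W (c, d))) = W (c, d)"
  using fst_W[of "(c, d)"] by (simp add: prod_eq_iff)

lemma Z_pair: "(c, d) \<in> R \<Longrightarrow> (fst (Z (c, d)), d) = Z (c, d)"
  using snd_Z[of "(c, d)"] by (simp add: prod_eq_iff)

lemma W_R': "(c, d) \<in> S \<Longrightarrow> (c, snd (W (c, d))) \<in> R"
  using W_R W_pair by simp

lemma \<xi>_W_hom: "(c, d) \<in> S \<Longrightarrow> \<xi> (W (c, d)) \<in> hom U (omap I c) (omap J (snd (W (c, d))))"
  using \<xi>_hom[OF W_R'] by (simp add: W_pair)

(* Pasting of commutative squares in U. *)
lemma paste: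
  assumes "f \<in> hom U a b" "g \<in> hom U b c" "x \<in> hom U a a'" "y \<in> hom U b b'" "z \<in> hom U c c'"
    and "f' \<in> hom U a' b'" "g' \<in> hom U b' c'"
    and "Comp U y f = Comp U f' x" "Comp U z g = Comp U g' y"
  shows "Comp U z (Comp U g f) = Comp U (Comp U g' f') x"
proof -
  have "Comp U z (Comp U g f) = Comp U (Comp U z g) f"
    using I.D.Comp_assoc[OF assms(1,2,5)] by simp
  also have "\<dots> = Comp U g' (Comp U y f)"
    using I.D.Comp_assoc[OF assms(1,4,7)] assms(9) by simp
  also have "\<dots> = Comp U (Comp U g' f') x"
    using I.D.Comp_assoc[OF assms(3,6,7)] assms(8) by simp
  finally show ?thesis .
qed

lemma Comp_sqR:
  assumes "sqR c d c' d' u v" "sqR c' d' c'' d'' u' v'"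
  shows "sqR c d c'' d'' (Comp H u' u) (Comp K v' v)"
proof -
  note a = assms[unfolded sqR_def]
  have "Comp U (\<xi> (c'', d'')) (Comp U (amap I u') (amap I u)) =
        Comp U (Comp U (amap J v') (amap J v)) (\<xi> (c, d))"
    by (rule paste[where y = "\<xi> (c', d')"]) (use a I.amap_hom J.amap_hom \<xi>_hom in blast)+
  moreover have "amap I (Comp H u' u) = Comp U (amap I u') (amap I u)"
      "amap J (Comp K v' v) = Comp U (amap J v') (amap J v)"
    using a I.amap_Comp J.amap_Comp by blast+
  ultimately show ?thesis unfolding sqR_def using a I.C.Comp_hom J.C.Comp_hom by auto
qed

lemma Comp_sqS:
  assumes "sqS c d c' d' z v w" "sqS c' d' c'' d'' z' v' w'"
  shows "sqS c d c'' d'' (Comp H z' z) (Comp K v' v) (Comp K w' w)"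
proof -
  note a = assms[unfolded sqS_def]
  have 1: "Comp U (\<chi> (c'', d'')) (Comp U (amap J v') (amap J v)) =
        Comp U (Comp U (amap I z') (amap I z)) (\<chi> (c, d))"
    by (rule paste[where y = "\<chi> (c', d')"]) (use a I.amap_hom J.amap_hom \<chi>_hom in blast)+
  have 2: "Comp U (\<xi> (W (c'', d''))) (Comp U (amap I z') (amap I z)) =
        Comp U (Comp U (amap J w') (amap J w)) (\<xi> (W (c, d)))"
    by (rule paste[where y = "\<xi> (W (c', d'))"]) (use a I.amap_hom J.amap_hom \<xi>_W_hom in blast)+
  have "amap I (Comp H z' z) = Comp U (amap I z') (amap I z)"
       "amap J (Comp K v' v) = Comp U (amap J v') (amap J v)"
       "amap J (Comp K w' w) = Comp U (amap J w') (amap J w)"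
    using a I.amap_Comp J.amap_Comp by blast+
  then show ?thesis unfolding sqS_def using 1 2 a I.C.Comp_hom J.C.Comp_hom by auto
qed

lemma Id_sqR:
  assumes "(c, d) \<in> R"
  shows "sqR c d c d (Id H c) (Id K d)"
proof -
  have "c \<in> Obj H" "d \<in> Obj K" using assms R_sub by auto
  moreover have "Comp U (\<xi> (c, d)) (Id U (omap I c)) = Comp U (Id U (omap J d)) (\<xi> (c, d))"
    using I.D.Comp_Id[OF \<xi>_hom[OF assms]] I.D.Id_Comp[OF \<xi>_hom[OF assms]] by simp
  ultimately show ?thesis unfolding sqR_def
    using assms I.C.Id_hom J.C.Id_hom by (simp add: I.amap_Id J.amap_Id)
qed

lemma Id_sqS:
  assumes "(c, d) \<in> S"
  shows "sqS c d c d (Id H c) (Id K d) (Id K (snd (W (c, d))))"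
proof -
  have o: "c \<in> Obj H" "d \<in> Obj K" "snd (W (c, d)) \<in> Obj K"
    using assms S_sub R_sub W_R' by blast+
  have "Comp U (\<chi> (c, d)) (Id U (omap J d)) = Comp U (Id U (omap I c)) (\<chi> (c, d))"
    using I.D.Comp_Id[OF \<chi>_hom[OF assms]] I.D.Id_Comp[OF \<chi>_hom[OF assms]] by simp
  moreover have "Comp U (\<xi> (W (c, d))) (Id U (omap I c)) =
      Comp U (Id U (omap J (snd (W (c, d))))) (\<xi> (W (c, d)))"
    using I.D.Comp_Id[OF \<xi>_W_hom[OF assms]] I.D.Id_Comp[OF \<xi>_W_hom[OF assms]] by simp
  ultimately show ?thesis unfolding sqS_def
    using assms o I.C.Id_hom J.C.Id_hom by (simp add: I.amap_Id J.amap_Id)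
qed

lemma category_R_tilde: "category RR"
proof
  fix f assume "f \<in> Arr RR"
  then show "Dom RR f \<in> Obj RR" "Cod RR f \<in> Obj RR"
    by (auto simp: R_tilde_def hom_def)
next
  fix p assume "p \<in> Obj RR"
  then show "Id RR p \<in> hom RR p p"
    unfolding homR using Id_sqR by (cases p) (auto simp: R_tilde_def)
next
  fix f g p q r assume "f \<in> hom RR p q" "g \<in> hom RR q r"
  then show "Comp RR g f \<in> hom RR p r"
    unfolding homR using Comp_sqR by (force simp: R_tilde_def)
next
  fix f p q assume "f \<in> hom RR p q"
  then show "Comp RR f (Id RR p) = f" "Comp RR (Id RR q) f = f"
    unfolding homR sqR_def
    by (auto simp: R_tilde_def I.C.Comp_Id J.C.Comp_Id I.C.Id_Comp J.C.Id_Comp)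
next
  fix f g h p q r s assume "f \<in> hom RR p q" "g \<in> hom RR q r" "h \<in> hom RR r s"
  then show "Comp RR (Comp RR h g) f = Comp RR h (Comp RR g f)"
    unfolding homR sqR_def
    by (auto simp: R_tilde_def intro: I.C.Comp_assoc J.C.Comp_assoc)
qed

lemma category_S_tilde: "category SS"
proof
  fix f assume "f \<in> Arr SS"
  then show "Dom SS f \<in> Obj SS" "Cod SS f \<in> Obj SS"
    by (auto simp: S_tilde_def hom_def)
next
  fix p assume "p \<in> Obj SS"
  then show "Id SS p \<in> hom SS p p"
    unfolding homS using Id_sqS by (cases p) (auto simp: S_tilde_def)
next
  fix f g p q r assume "f \<in> hom SS p q" "g \<in> hom SS q r"
  then show "Comp SS g f \<in> hom SS p r"
    unfolding homS using Comp_sqS by (force simp: S_tilde_def)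
next
  fix f p q assume "f \<in> hom SS p q"
  then show "Comp SS f (Id SS p) = f" "Comp SS (Id SS q) f = f"
    unfolding homS sqS_def
    by (auto simp: S_tilde_def I.C.Comp_Id J.C.Comp_Id I.C.Id_Comp J.C.Id_Comp)
next
  fix f g h p q r s assume "f \<in> hom SS p q" "g \<in> hom SS q r" "h \<in> hom SS r s"
  then show "Comp SS (Comp SS h g) f = Comp SS h (Comp SS g f)"
    unfolding homS sqS_def
    by (auto simp: S_tilde_def intro: I.C.Comp_assoc J.C.Comp_assoc)
qed

lemma functor_W_tilde: "cat_functor SS RR (W_tilde W)"
proof (intro cat_functor.intro cat_functor_axioms.intro category_R_tilde category_S_tilde)
  fix p assume p: "p \<in> Obj SS"
  then show "omap (W_tilde W) p \<in> Obj RR"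
    using W_R by (auto simp: S_tilde_def R_tilde_def W_tilde_def)
  obtain c d where cd: "p = (c, d)" "(c, d) \<in> S" using p by (cases p) (auto simp: S_tilde_def)
  show "amap (W_tilde W) (Id SS p) = Id RR (omap (W_tilde W) p)"
    using fst_W[OF cd(2)] cd(1)
    by (cases "W (c, d)") (simp add: S_tilde_def R_tilde_def W_tilde_def)
next
  fix f p q assume "f \<in> hom SS p q"
  then obtain c d c' d' z v w
    where f: "p = (c, d)" "q = (c', d')" "f = (z, v, w)" "sqS c d c' d' z v w" unfolding homS by blast
  have "sqR c (snd (W (c, d))) c' (snd (W (c', d'))) z w"
    using f(4) W_R' unfolding sqS_def sqR_def by (simp add: W_pair)
  then show "amap (W_tilde W) f \<in> hom RR (omap (W_tilde W) p) (omap (W_tilde W) q)"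
    using f W_pair[of c d] W_pair[of c' d'] unfolding homR sqS_def
    by (cases "W (c, d)"; cases "W (c', d')") (simp add: W_tilde_def)
next
  fix f g p q r assume "f \<in> hom SS p q" "g \<in> hom SS q r"
  then show "amap (W_tilde W) (Comp SS g f) = Comp RR (amap (W_tilde W) g) (amap (W_tilde W) f)"
    by (cases f; cases g) (auto simp: W_tilde_def S_tilde_def R_tilde_def)
qed

end

context relational_reflection_data
begin

abbreviation "zz p p' u \<equiv> Comp H (inv_arr H (\<epsilon>' p')) (Comp H u (\<epsilon>' p))"
abbreviation "isw p p' v w \<equiv> w \<in> hom K (snd (W (Z p))) (snd (W (Z p'))) \<and>
                 Comp K w (\<eta>' (Z p)) = Comp K (\<eta>' (Z p')) v"

lemma \<eta>'_Z_hom: "(c, d) \<in> R \<Longrightarrow> \<eta>' (Z (c, d)) \<in> hom K d (snd (W (Z (c, d))))"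
  using \<eta>'_hom[of "fst (Z (c, d))" d] Z_S by (simp add: Z_pair)

lemma Z_tilde_arrow_unique:
  assumes "(c, d) \<in> R" "(c', d') \<in> R" "v \<in> hom K d d'"
  shows "\<exists>!w. isw (c, d) (c', d') v w"
proof -
  let ?e = "\<eta>' (Z (c, d))" and ?e' = "\<eta>' (Z (c', d'))"
  note h = \<eta>'_Z_hom[OF assms(1)] \<eta>'_Z_hom[OF assms(2)]
  note i = J.C.inv_arr[OF \<eta>'_Z_iso[OF assms(1)] h(1)]
  have c: "Comp K ?e' v \<in> hom K d (snd (W (Z (c', d'))))" using J.C.Comp_hom assms(3) h(2) by blast
  let ?w = "Comp K (Comp K ?e' v) (inv_arr K ?e)"
  have "isw (c, d) (c', d') v ?w"
    using J.C.Comp_hom[OF i(1) c] J.C.Comp_assoc[OF h(1) i(1) c] J.C.Comp_Id[OF c] i(2) by simp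
  moreover have "w = w'" if "isw (c, d) (c', d') v w" "isw (c, d) (c', d') v w'" for w w'
    using J.C.iso_right_cancel[OF \<eta>'_Z_iso[OF assms(1)] h(1)] that by metis
  ultimately show ?thesis by blast
qed

lemma Z_tilde_amap:
  assumes "sqR c d c' d' u v" "isw (c, d) (c', d') v w"
  shows "amap (Z_tilde H K Z W \<epsilon>' \<eta>') (u, v) = (zz (c, d) (c', d') u, v, w)"
proof -
  have "\<exists>!w. isw (c, d) (c', d') v w"
    using assms(1) unfolding sqR_def by (intro Z_tilde_arrow_unique) simp_all
  from the1_equality[OF this assms(2)] have "(THE w. isw (c, d) (c', d') v w) = w" .
  moreover have "Dom H u = c" "Cod H u = c'" "Dom K v = d" "Cod K v = d'"
    using assms(1) by (auto simp: sqR_def hom_def)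
  ultimately show ?thesis by (simp add: Z_tilde_def)
qed

lemma zz_hom:
  assumes "(c, d) \<in> R" "(c', d') \<in> R" "u \<in> hom H c c'"
  shows "zz (c, d) (c', d') u \<in> hom H (fst (Z (c, d))) (fst (Z (c', d')))"
  using I.C.Comp_hom[OF I.C.Comp_hom[OF \<epsilon>'_hom[OF assms(1)] assms(3)]
      I.C.inv_arr(1)[OF \<epsilon>'_iso[OF assms(2)] \<epsilon>'_hom[OF assms(2)]]] .

lemma \<chi>_Z_hom: "(c, d) \<in> R \<Longrightarrow> \<chi> (Z (c, d)) \<in> hom U (omap J d) (omap I (fst (Z (c, d))))"
  using \<chi>_hom[of "fst (Z (c, d))" d] Z_S by (simp add: Z_pair)

lemma Z_tilde_sq:
  assumes "sqR c d c' d' u v" "isw (c, d) (c', d') v w"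
  shows "sqS (fst (Z (c, d))) d (fst (Z (c', d'))) d' (zz (c, d) (c', d') u) v w"
proof -
  let ?z = "zz (c, d) (c', d') u"
  let ?x = "\<xi> (c, d)" and ?x' = "\<xi> (c', d')" and ?k = "\<chi> (Z (c, d))" and ?k' = "\<chi> (Z (c', d'))"
  let ?y = "\<xi> (W (Z (c, d)))" and ?y' = "\<xi> (W (Z (c', d')))"
  let ?e = "\<epsilon>' (c, d)" and ?e' = "\<epsilon>' (c', d')"
  have r: "(c, d) \<in> R" and r': "(c', d') \<in> R" and u: "u \<in> hom H c c'" and v: "v \<in> hom K d d'"
    and sq: "Comp U ?x' (amap I u) = Comp U (amap J v) ?x"
    using assms(1) by (auto simp: sqR_def)
  note z = zz_hom[OF r r' u]
  note e = \<epsilon>'_hom[OF r] and e' = \<epsilon>'_hom[OF r']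
  note ie = I.C.inv_arr[OF \<epsilon>'_iso[OF r] e] and ie' = I.C.inv_arr[OF \<epsilon>'_iso[OF r'] e']
  note x = \<xi>_hom[OF r] and x' = \<xi>_hom[OF r'] and k = \<chi>_Z_hom[OF r] and k' = \<chi>_Z_hom[OF r']
  note Iu = I.amap_hom[OF u] and Jv = J.amap_hom[OF v] and Iz = I.amap_hom[OF z]
  have s: "(fst (Z (c, d)), d) \<in> S" "(fst (Z (c', d')), d') \<in> S" using Z_S r r' by (simp_all add: Z_pair)
  have y: "?y \<in> hom U (omap I (fst (Z (c, d)))) (omap J (snd (W (Z (c, d)))))"
    using \<xi>_W_hom[OF s(1)] Z_pair[OF r] by simp
  have y': "?y' \<in> hom U (omap I (fst (Z (c', d')))) (omap J (snd (W (Z (c', d')))))"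
    using \<xi>_W_hom[OF s(2)] Z_pair[OF r'] by simp
  have Jw: "amap J w \<in> hom U (omap J (snd (W (Z (c, d))))) (omap J (snd (W (Z (c', d')))))"
    using J.amap_hom assms(2) by blast
  have zi: "Comp H ?z (inv_arr H ?e) = Comp H (inv_arr H ?e') u"
    using I.C.Comp_assoc[OF ie(1) I.C.Comp_hom[OF e u] ie'(1)] I.C.Comp_assoc[OF ie(1) e u] ie(3) I.C.Comp_Id[OF u]
    by simp
  have 1: "Comp U ?k' (amap J v) = Comp U (amap I ?z) ?k"
  proof (rule I.D.iso_right_cancel[OF \<xi>_iso[OF r] x])
    show "Comp U ?k' (amap J v) \<in> hom U (omap J d) (omap I (fst (Z (c', d'))))"
      using Jv k' I.D.Comp_hom by blast
    show "Comp U (amap I ?z) ?k \<in> hom U (omap J d) (omap I (fst (Z (c', d'))))"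
      using k Iz I.D.Comp_hom by blast
    have "Comp U (Comp U ?k' (amap J v)) ?x = Comp U ?k' (Comp U ?x' (amap I u))"
      using I.D.Comp_assoc[OF x Jv k'] sq by simp
    also have "\<dots> = Comp U (Comp U ?k' ?x') (amap I u)"
      using I.D.Comp_assoc[OF Iu x' k'] by simp
    also have "\<dots> = amap I (Comp H (inv_arr H ?e') u)"
      using \<chi>_\<xi>[OF r'] I.amap_Comp[OF u ie'(1)] by simp
    also have "\<dots> = Comp U (amap I ?z) (amap I (inv_arr H ?e))"
      using zi I.amap_Comp[OF ie(1) z] by simp
    also have "\<dots> = Comp U (Comp U (amap I ?z) ?k) ?x"
      using I.D.Comp_assoc[OF x k Iz] \<chi>_\<xi>[OF r] by simp
    finally show "Comp U (Comp U ?k' (amap J v)) ?x = Comp U (Comp U (amap I ?z) ?k) ?x" .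
  qed
  have yk: "Comp U ?y ?k = amap J (\<eta>' (Z (c, d)))" "Comp U ?y' ?k' = amap J (\<eta>' (Z (c', d')))"
    using \<xi>_\<chi>[OF s(1)] \<xi>_\<chi>[OF s(2)] Z_pair r r' by simp_all
  have "Comp U (Comp U ?y' (amap I ?z)) ?k = Comp U ?y' (Comp U ?k' (amap J v))"
    using I.D.Comp_assoc[OF k Iz y'] 1 by simp
  also have "\<dots> = Comp U (amap J (\<eta>' (Z (c', d')))) (amap J v)"
    using I.D.Comp_assoc[OF Jv k' y'] yk by simp
  also have "\<dots> = amap J (Comp K w (\<eta>' (Z (c, d))))"
    using J.amap_Comp[OF v \<eta>'_Z_hom[OF r']] assms(2) by simp
  also have "\<dots> = Comp U (amap J w) (amap J (\<eta>' (Z (c, d))))"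
    using J.amap_Comp[OF \<eta>'_Z_hom[OF r] conjunct1[OF assms(2)]] .
  also have "\<dots> = Comp U (Comp U (amap J w) ?y) ?k"
    using yk I.D.Comp_assoc[OF k y Jw] by simp
  finally have yk2: "Comp U (Comp U ?y' (amap I ?z)) ?k = Comp U (Comp U (amap J w) ?y) ?k" .
  have yz: "Comp U ?y' (amap I ?z) \<in> hom U (omap I (fst (Z (c, d)))) (omap J (snd (W (Z (c', d')))))"
    using Iz y' I.D.Comp_hom by blast
  have wy: "Comp U (amap J w) ?y \<in> hom U (omap I (fst (Z (c, d)))) (omap J (snd (W (Z (c', d')))))"
    using y Jw I.D.Comp_hom by blast
  \<comment> \<open>\<open>\<chi> (Z (c, d))\<close> is a split epimorphism\<close>
  let ?r = "Comp U ?x (amap I ?e)"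
  have rh: "?r \<in> hom U (omap I (fst (Z (c, d)))) (omap J d)"
    using x I.amap_hom[OF e] I.D.Comp_hom by blast
  have "Comp U ?k ?r = Comp U (amap I (inv_arr H ?e)) (amap I ?e)"
    using I.D.Comp_assoc[OF I.amap_hom[OF e] x k] \<chi>_\<xi>[OF r] by simp
  also have "\<dots> = Id U (omap I (fst (Z (c, d))))"
    using I.amap_Comp[OF e ie(1)] ie(2) I.amap_Id I.C.hom_Obj[OF e] by simp
  finally have kr: "Comp U ?k ?r = Id U (omap I (fst (Z (c, d))))" .
  have "Comp U ?y' (amap I ?z) = Comp U (Comp U (Comp U ?y' (amap I ?z)) ?k) ?r"
    unfolding I.D.Comp_assoc[OF rh k yz] kr I.D.Comp_Id[OF yz] ..
  also have "\<dots> = Comp U (amap J w) ?y"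
    unfolding yk2 I.D.Comp_assoc[OF rh k wy] kr I.D.Comp_Id[OF wy] ..
  finally have 2: "Comp U ?y' (amap I ?z) = Comp U (amap J w) ?y" .
  show ?thesis unfolding sqS_def using s z v assms(2) 1 2 Z_pair[OF r] Z_pair[OF r'] by simp
qed

lemma functor_Z_tilde: "cat_functor RR SS (Z_tilde H K Z W \<epsilon>' \<eta>')" (is "cat_functor _ _ ?F")
proof (intro cat_functor.intro cat_functor_axioms.intro category_R_tilde category_S_tilde)
  fix p assume p: "p \<in> Obj RR"
  then show "omap ?F p \<in> Obj SS"
    using Z_S by (auto simp: S_tilde_def R_tilde_def Z_tilde_def)
  obtain c d where cd: "p = (c, d)" and r: "(c, d) \<in> R" using p by (cases p) (auto simp: R_tilde_def)
  note e = \<epsilon>'_hom[OF r]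
  note ie = I.C.inv_arr[OF \<epsilon>'_iso[OF r] e]
  have "isw (c, d) (c, d) (Id K d) (Id K (snd (W (Z (c, d)))))"
    using J.C.Id_Comp[OF \<eta>'_Z_hom[OF r]] J.C.Comp_Id[OF \<eta>'_Z_hom[OF r]]
      J.C.hom_Obj[OF \<eta>'_Z_hom[OF r]] J.C.Id_hom by simp
  from Z_tilde_amap[OF Id_sqR[OF r] this]
  have "amap ?F (Id H c, Id K d) = (Id H (fst (Z (c, d))), Id K d, Id K (snd (W (Z (c, d)))))"
    using ie(2) I.C.Id_Comp[OF e] by simp
  then show "amap ?F (Id RR p) = Id SS (omap ?F p)"
    using cd snd_Z[OF r] by (cases "Z (c, d)") (simp add: R_tilde_def S_tilde_def Z_tilde_def)
next
  fix f p q assume "f \<in> hom RR p q"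
  then obtain c d c' d' u v
    where f: "p = (c, d)" "q = (c', d')" "f = (u, v)" "sqR c d c' d' u v" unfolding homR by blast
  obtain w where w: "isw (c, d) (c', d') v w"
    using Z_tilde_arrow_unique[of c d c' d' v] f(4) unfolding sqR_def by auto
  have "(c, d) \<in> R" "(c', d') \<in> R" using f(4) unfolding sqR_def by simp_all
  then obtain a a' where "Z (c, d) = (a, d)" "Z (c', d') = (a', d')"
    by (metis Z_pair)
  then show "amap ?F f \<in> hom SS (omap ?F p) (omap ?F q)"
    unfolding homS using Z_tilde_amap[OF f(4) w] Z_tilde_sq[OF f(4) w] f by (auto simp: Z_tilde_def)
next
  fix f g p q r assume "f \<in> hom RR p q" "g \<in> hom RR q r"
  then obtain c d c' d' c'' d'' u v u' v'
    where f: "p = (c, d)" "q = (c', d')" "r = (c'', d'')" "f = (u, v)" "g = (u', v')"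
      and sq: "sqR c d c' d' u v" and sq': "sqR c' d' c'' d'' u' v'" unfolding homR by blast
  have r: "(c, d) \<in> R" and r': "(c', d') \<in> R" and r'': "(c'', d'') \<in> R"
    and u: "u \<in> hom H c c'" and u': "u' \<in> hom H c' c''"
    and v: "v \<in> hom K d d'" and v': "v' \<in> hom K d' d''"
    using sq sq' by (auto simp: sqR_def)
  obtain w where w: "isw (c, d) (c', d') v w" using Z_tilde_arrow_unique[OF r r' v] by blast
  obtain w' where w': "isw (c', d') (c'', d'') v' w'" using Z_tilde_arrow_unique[OF r' r'' v'] by blast
  note h = \<eta>'_Z_hom[OF r] \<eta>'_Z_hom[OF r'] \<eta>'_Z_hom[OF r'']
  have ww: "isw (c, d) (c'', d'') (Comp K v' v) (Comp K w' w)"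
  proof
    show "Comp K w' w \<in> hom K (snd (W (Z (c, d)))) (snd (W (Z (c'', d''))))"
      using J.C.Comp_hom w w' by blast
    have "Comp K (Comp K w' w) (\<eta>' (Z (c, d))) = Comp K w' (Comp K (\<eta>' (Z (c', d'))) v)"
      using J.C.Comp_assoc[OF h(1) conjunct1[OF w] conjunct1[OF w']] w by simp
    also have "\<dots> = Comp K (\<eta>' (Z (c'', d''))) (Comp K v' v)"
      using J.C.Comp_assoc[OF v h(2) conjunct1[OF w']] J.C.Comp_assoc[OF v v' h(3)] w' by simp
    finally show "Comp K (Comp K w' w) (\<eta>' (Z (c, d))) = Comp K (\<eta>' (Z (c'', d''))) (Comp K v' v)" .
  qed
  note e = \<epsilon>'_hom[OF r] \<epsilon>'_hom[OF r'] \<epsilon>'_hom[OF r'']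
  note i' = I.C.inv_arr[OF \<epsilon>'_iso[OF r'] e(2)] and i'' = I.C.inv_arr[OF \<epsilon>'_iso[OF r''] e(3)]
  have ue: "Comp H u (\<epsilon>' (c, d)) \<in> hom H (fst (Z (c, d))) c'" using e u I.C.Comp_hom by blast
  have z: "zz (c, d) (c', d') u \<in> hom H (fst (Z (c, d))) (fst (Z (c', d')))" using zz_hom r r' u .
  have ez: "Comp H (\<epsilon>' (c', d')) (zz (c, d) (c', d') u) = Comp H u (\<epsilon>' (c, d))"
    using I.C.Comp_assoc[OF ue i'(1) e(2)] i'(3) I.C.Id_Comp[OF ue] by simp
  have ue': "Comp H u' (\<epsilon>' (c', d')) \<in> hom H (fst (Z (c', d'))) c''" using e u' I.C.Comp_hom by blast
  have "Comp H (zz (c', d') (c'', d'') u') (zz (c, d) (c', d') u) =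
        Comp H (inv_arr H (\<epsilon>' (c'', d''))) (Comp H (Comp H u' (\<epsilon>' (c', d'))) (zz (c, d) (c', d') u))"
    using I.C.Comp_assoc[OF z ue' i''(1)] .
  also have "\<dots> = Comp H (inv_arr H (\<epsilon>' (c'', d''))) (Comp H u' (Comp H u (\<epsilon>' (c, d))))"
    using I.C.Comp_assoc[OF z e(2) u'] ez by simp
  also have "\<dots> = zz (c, d) (c'', d'') (Comp H u' u)"
    using I.C.Comp_assoc[OF e(1) u u'] by simp
  finally have "zz (c, d) (c'', d'') (Comp H u' u) =
    Comp H (zz (c', d') (c'', d'') u') (zz (c, d) (c', d') u)" by simp
  then show "amap ?F (Comp RR g f) = Comp SS (amap ?F g) (amap ?F f)"
    using Z_tilde_amap[OF sq w] Z_tilde_amap[OF sq' w'] Z_tilde_amap[OF Comp_sqR[OF sq sq'] ww] f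
    by (simp add: R_tilde_def S_tilde_def)
qed

end

end

theory Submission imports Defs begin

text \<open>
  The common category is \<open>U = A\<close>, with \<open>I\<close> the identity and \<open>J = L\<close>; the relations are the graphs of
  the two functors, \<open>R = {(a, G a)}\<close> and \<open>S = {(L b, b)}\<close>. Over them, \<open>\<xi> (a, G a)\<close> is the inverse
  counit \<open>a \<rightarrow> L (G a)\<close> and \<open>\<chi> (L b, b)\<close> is the identity of \<open>L b\<close>, while
  \<open>Z (a, G a) = (L (G a), G a)\<close> and \<open>W (L b, b) = (L b, G (L b))\<close>. The chosen arrows are
  the counit and the unit, \<open>\<epsilon>' (a, G a) = \<epsilon> a\<close> and \<open>\<eta>' (L b, b) = \<eta> b\<close>. The composite \<open>\<chi> \<circ> \<xi>\<close> is
  then \<open>(\<epsilon> a)\<^sup>-\<^sup>1\<close> on the nose. The composite \<open>\<xi> \<circ> \<chi>\<close> is \<open>(\<epsilon> (L b))\<^sup>-\<^sup>1\<close>, which has to be \<open>L (\<eta> b)\<close>;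
  this is one triangle identity (lemma \<open>L_unit_inverse\<close>). The other one makes \<open>\<eta> (G a)\<close> an
  isomorphism (lemma \<open>unit_G_iso\<close>).

  What remains is that the squares defining the arrows leave no freedom. For \<open>u : a \<rightarrow> a'\<close>, naturality
  of the counit makes the square on \<open>(u, v)\<close> commute when \<open>v = G u\<close>; because \<open>v \<mapsto> \<epsilon> a' \<circ> L v\<close> is the
  injective adjoint transposition, it commutes for no other \<open>v\<close> (lemma \<open>counit_square_iff\<close>). So the
  category on \<open>R\<close> is the graph of \<open>G\<close>, also on arrows, and projects isomorphically to \<open>A\<close>. In the
  category on \<open>S\<close>, the \<open>\<chi>\<close>-square forces \<open>z = L v\<close> and the \<open>\<xi>\<close>-square, by the same lemma, \<open>w = G z\<close>;
  its arrows are the triples \<open>(L v, v, G (L v))\<close>, and it projects isomorphically to \<open>B\<close>. Under these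
  projections the functors induced by \<open>Z\<close> and \<open>W\<close> are \<open>G\<close> and \<open>L\<close> by inspection.
\<close>

section \<open>Inverse arrows\<close>

lemma Arr_iff_hom: "f \<in> Arr C \<longleftrightarrow> (\<exists>p q. f \<in> hom C p q)"
  by (simp add: hom_def)

lemma functor_eq_id_iff:
  "functor_eq C F id_functor \<longleftrightarrow> (\<forall>a\<in>Obj C. omap F a = a) \<and> (\<forall>f\<in>Arr C. amap F f = f)"
  by (simp add: functor_eq_def id_functor_def)

lemma (in category) isoI:
  assumes "f \<in> hom C a b" "g \<in> hom C b a" "Comp C g f = Id C a" "Comp C f g = Id C b"
  shows "iso C f"
  using assms by (auto simp: iso_def inverse_arrows_def hom_def)

text \<open>Turns each triangle identity, a one-sided inverse law, into a statement on two-sided inverses.\<close>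

lemma (in category) inv_arr_of_section:
  assumes "iso C f" "f \<in> hom C a b" "g \<in> hom C b a" "Comp C f g = Id C b"
  shows "inv_arr C f = g" and "iso C g"
proof -
  note h = inv_arr[OF assms(1,2)]
  have "inv_arr C f = Comp C (inv_arr C f) (Comp C f g)"
    using Comp_Id[OF h(1)] assms(4) by simp
  also have "\<dots> = g"
    using Comp_assoc[OF assms(3,2) h(1)] h(2) Id_Comp[OF assms(3)] by simp
  finally show eq: "inv_arr C f = g" .
  show "iso C g" using isoI[OF assms(3,2)] h(2,3) eq by simp
qed

lemma (in category) iso_inv_arr:
  assumes "iso C f"
  shows "iso C (inv_arr C f)"
  using inv_arr_inverse[OF assms] isoI[of "inv_arr C f" "Cod C f" "Dom C f" f]
  by (auto simp: inverse_arrows_def hom_def)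

lemma (in category) inv_arr_square_iff:
  assumes e: "iso C e" "e \<in> hom C x a" and e': "iso C e'" "e' \<in> hom C x' a'"
    and u: "u \<in> hom C a a'" and l: "l \<in> hom C x x'"
  shows "Comp C (inv_arr C e') u = Comp C l (inv_arr C e) \<longleftrightarrow> Comp C u e = Comp C e' l"
proof -
  note i = inv_arr[OF e] and i' = inv_arr[OF e']
  show ?thesis
  proof
    assume eq: "Comp C (inv_arr C e') u = Comp C l (inv_arr C e)"
    have "Comp C u e = Comp C (Comp C e' (Comp C (inv_arr C e') u)) e"
      using Comp_assoc[OF u i'(1) e'(2)] i'(3) Id_Comp[OF u] by simp
    also have "\<dots> = Comp C e' (Comp C (Comp C l (inv_arr C e)) e)"
      using Comp_assoc[OF e(2) Comp_hom[OF i(1) l] e'(2)] eq by simp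
    also have "\<dots> = Comp C e' l"
      using Comp_assoc[OF e(2) i(1) l] i(2) Comp_Id[OF l] by simp
    finally show "Comp C u e = Comp C e' l" .
  next
    assume eq: "Comp C u e = Comp C e' l"
    have "Comp C (inv_arr C e') u = Comp C (inv_arr C e') (Comp C (Comp C u e) (inv_arr C e))"
      using Comp_assoc[OF i(1) e(2) u] i(3) Comp_Id[OF u] by simp
    also have "\<dots> = Comp C (Comp C (inv_arr C e') (Comp C e' l)) (inv_arr C e)"
      using Comp_assoc[OF i(1) Comp_hom[OF l e'(2)] i'(1)] eq by simp
    also have "\<dots> = Comp C l (inv_arr C e)"
      using Comp_assoc[OF l e'(2) i'(1)] i'(2) Id_Comp[OF l] by simp
    finally show "Comp C (inv_arr C e') u = Comp C l (inv_arr C e)" .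
  qed
qed

section \<open>Adjoint transposition and reflections\<close>

context adjunction
begin

lemma counit_hom: "a \<in> Obj A \<Longrightarrow> \<epsilon> a \<in> hom A (omap L (omap G a)) a"
  using counit.component_hom by (simp add: comp_functor_def id_functor_def)

lemma unit_hom: "b \<in> Obj B \<Longrightarrow> \<eta> b \<in> hom B b (omap G (omap L b))"
  using unit.component_hom by (simp add: comp_functor_def id_functor_def)

lemma counit_natural:
  "u \<in> hom A a a' \<Longrightarrow> Comp A (\<epsilon> a') (amap L (amap G u)) = Comp A u (\<epsilon> a)"
  using counit.naturality by (simp add: comp_functor_def id_functor_def)

lemma unit_natural:
  "v \<in> hom B b b' \<Longrightarrow> Comp B (\<eta> b') v = Comp B (amap G (amap L v)) (\<eta> b)"
  using unit.naturality by (simp add: comp_functor_def id_functor_def)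

text \<open>The transpose of \<open>\<epsilon> a \<circ> L v\<close> is \<open>v\<close> again, by naturality of the unit and a triangle identity.\<close>

lemma transpose_transpose:
  assumes a: "a \<in> Obj A" and v: "v \<in> hom B b (omap G a)"
  shows "Comp B (amap G (Comp A (\<epsilon> a) (amap L v))) (\<eta> b) = v"
proof -
  have b: "b \<in> Obj B" and Ga: "omap G a \<in> Obj B" using G.D.hom_Obj[OF v] by simp_all
  note Lv = L.amap_hom[OF v]
  note GLv = G.amap_hom[OF Lv] and Ge = G.amap_hom[OF counit_hom[OF a]]
  have "Comp B (amap G (Comp A (\<epsilon> a) (amap L v))) (\<eta> b) =
        Comp B (amap G (\<epsilon> a)) (Comp B (amap G (amap L v)) (\<eta> b))"
    using G.amap_Comp[OF Lv counit_hom[OF a]] G.D.Comp_assoc[OF unit_hom[OF b] GLv Ge] by simp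
  also have "\<dots> = Comp B (Comp B (amap G (\<epsilon> a)) (\<eta> (omap G a))) v"
    using unit_natural[OF v] G.D.Comp_assoc[OF v unit_hom[OF Ga] Ge] by simp
  also have "\<dots> = v" using triangle_G[OF a] G.D.Id_Comp[OF v] by simp
  finally show ?thesis .
qed

lemma counit_transpose_inject:
  assumes "a \<in> Obj A" "v \<in> hom B b (omap G a)" "v' \<in> hom B b (omap G a)"
    and "Comp A (\<epsilon> a) (amap L v) = Comp A (\<epsilon> a) (amap L v')"
  shows "v = v'"
  using transpose_transpose[OF assms(1,2), unfolded assms(4)] transpose_transpose[OF assms(1,3)]
  by (rule trans[OF sym])

end

context reflection
begin

lemma inv_counit_hom: "a \<in> Obj A \<Longrightarrow> inv_arr A (\<epsilon> a) \<in> hom A a (omap L (omap G a))"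
  using G.C.inv_arr(1)[OF counit_iso counit_hom] .

lemma L_unit_inverse:
  assumes "b \<in> Obj B"
  shows "inv_arr A (\<epsilon> (omap L b)) = amap L (\<eta> b)"
proof -
  have Lb: "omap L b \<in> Obj A" using L.omap_Obj assms .
  show ?thesis
    by (rule G.C.inv_arr_of_section(1)[OF counit_iso[OF Lb] counit_hom[OF Lb]
          L.amap_hom[OF unit_hom[OF assms]] triangle_L[OF assms]])
qed

lemma unit_G_iso:
  assumes a: "a \<in> Obj A"
  shows "iso B (\<eta> (omap G a))"
proof -
  note e = counit_hom[OF a] and i = G.C.inv_arr[OF counit_iso[OF a] counit_hom[OF a]]
  have Ga: "omap G a \<in> Obj B" using G.omap_Obj a .
  have LGa: "omap L (omap G a) \<in> Obj A" using L.omap_Obj Ga .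
  have "iso B (amap G (\<epsilon> a))"
    using G.D.isoI[OF G.amap_hom[OF e] G.amap_hom[OF i(1)]]
      G.amap_Comp[OF e i(1)] G.amap_Comp[OF i(1) e] i(2,3) G.amap_Id a LGa by simp
  from G.D.inv_arr_of_section(2)[OF this G.amap_hom[OF e] unit_hom[OF Ga] triangle_G[OF a]]
  show ?thesis .
qed

text \<open>
  Conjugation by the counits turns the square into \<open>u \<circ> \<epsilon> a = \<epsilon> a' \<circ> L v\<close>. By naturality of the
  counit the left side is \<open>\<epsilon> a' \<circ> L (G u)\<close>, so the equation says that \<open>v\<close> and \<open>G u\<close> have the same
  transpose.
\<close>

lemma counit_square_iff:
  assumes u: "u \<in> hom A a a'" and v: "v \<in> hom B (omap G a) (omap G a')"
  shows "Comp A (inv_arr A (\<epsilon> a')) u = Comp A (amap L v) (inv_arr A (\<epsilon> a)) \<longleftrightarrow> v = amap G u"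
proof -
  have a: "a \<in> Obj A" and a': "a' \<in> Obj A" using G.C.hom_Obj[OF u] by simp_all
  have "Comp A (inv_arr A (\<epsilon> a')) u = Comp A (amap L v) (inv_arr A (\<epsilon> a)) \<longleftrightarrow>
        Comp A u (\<epsilon> a) = Comp A (\<epsilon> a') (amap L v)"
    using G.C.inv_arr_square_iff[OF counit_iso[OF a] counit_hom[OF a] counit_iso[OF a']
        counit_hom[OF a'] u L.amap_hom[OF v]] .
  also have "\<dots> \<longleftrightarrow> v = amap G u"
    using counit_transpose_inject[OF a' v G.amap_hom[OF u]] counit_natural[OF u] by auto
  finally show ?thesis .
qed

section \<open>The construction on the graphs of the two functors\<close>

definition R_graph :: "('a \<times> 'c) set" where
  "R_graph = {(a, omap G a) |a. a \<in> Obj A}"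

definition S_graph :: "('a \<times> 'c) set" where
  "S_graph = {(omap L b, b) |b. b \<in> Obj B}"

abbreviation "xi \<equiv> \<lambda>p :: 'a \<times> 'c. inv_arr A (\<epsilon> (fst p))"
abbreviation "chi \<equiv> \<lambda>p :: 'a \<times> 'c. Id A (fst p)"
abbreviation "Zmap \<equiv> \<lambda>p :: 'a \<times> 'c. (omap L (snd p), snd p)"
abbreviation "Wmap \<equiv> \<lambda>p :: 'a \<times> 'c. (fst p, omap G (fst p))"
abbreviation "eps \<equiv> \<lambda>p :: 'a \<times> 'c. \<epsilon> (fst p)"
abbreviation "eta \<equiv> \<lambda>p :: 'a \<times> 'c. \<eta> (snd p)"

lemma graph_data:
  "relational_reflection_data A B A id_functor L R_graph S_graph xi chi Zmap Wmap eps eta"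
proof unfold_locales
  show "R_graph \<subseteq> Obj A \<times> Obj B" "S_graph \<subseteq> Obj A \<times> Obj B"
    by (auto simp: R_graph_def S_graph_def G.omap_Obj L.omap_Obj)
next
  fix c d assume "(c, d) \<in> R_graph"
  then have c: "c \<in> Obj A" and d: "d = omap G c" by (auto simp: R_graph_def)
  show "xi (c, d) \<in> hom A (omap id_functor c) (omap L d)"
    using inv_counit_hom[OF c] d by (simp add: id_functor_def)
  show "eps (c, d) \<in> hom A (fst (Zmap (c, d))) c" using counit_hom[OF c] d by simp
  show "iso A (eps (c, d))" using counit_iso[OF c] by simp
  show "iso A (xi (c, d))" using G.C.iso_inv_arr[OF counit_iso[OF c]] by simp
  show "Comp A (chi (Zmap (c, d))) (xi (c, d)) = amap id_functor (inv_arr A (eps (c, d)))"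
    using G.C.Id_Comp[OF inv_counit_hom[OF c]] d by (simp add: id_functor_def)
  show "iso B (eta (Zmap (c, d)))" using unit_G_iso[OF c] d by simp
next
  fix c d assume "(c, d) \<in> S_graph"
  then have d: "d \<in> Obj B" and c: "c = omap L d" by (auto simp: S_graph_def)
  have Lc: "omap L d \<in> Obj A" using L.omap_Obj d .
  show "chi (c, d) \<in> hom A (omap L d) (omap id_functor c)"
    using G.C.Id_hom[OF Lc] c by (simp add: id_functor_def)
  show "eta (c, d) \<in> hom B d (snd (Wmap (c, d)))" using unit_hom[OF d] c by simp
  show "Comp A (xi (Wmap (c, d))) (chi (c, d)) = amap L (eta (c, d))"
    using G.C.Comp_Id[OF inv_counit_hom[OF Lc]] L_unit_inverse[OF d] c by simp
qed (auto simp: R_graph_def S_graph_def G.omap_Obj L.omap_Obj)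

interpretation graph:
  relational_reflection_data A B A id_functor L R_graph S_graph xi chi Zmap Wmap eps eta
  by (rule graph_data)

text \<open>
  The squares of the construction determine every arrow from its \<open>u\<close> or its \<open>v\<close> component; both
  isomorphisms of categories rest on these two equivalences.
\<close>

lemma sqR_graph_iff:
  "graph.sqR c d c' d' u v \<longleftrightarrow>
     d = omap G c \<and> d' = omap G c' \<and> u \<in> hom A c c' \<and> v = amap G u"
  using counit_square_iff[of u c c' v] G.amap_hom[of u c c'] G.C.hom_Obj[of u c c']
  unfolding graph.sqR_def by (auto simp: R_graph_def id_functor_def)

lemma sqS_graph_iff:
  "graph.sqS c d c' d' z v w \<longleftrightarrow>
     c = omap L d \<and> c' = omap L d' \<and> v \<in> hom B d d' \<and> z = amap L v \<and> w = amap G z"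
proof -
  have "Comp A (Id A (omap L d')) (amap L v) = Comp A z (Id A (omap L d)) \<longleftrightarrow> z = amap L v"
    if "v \<in> hom B d d'" "z \<in> hom A (omap L d) (omap L d')"
    using G.C.Id_Comp[OF L.amap_hom[OF that(1)]] G.C.Comp_Id[OF that(2)] by auto
  moreover have "amap L v \<in> hom A (omap L d) (omap L d')" "d \<in> Obj B" "d' \<in> Obj B"
    if "v \<in> hom B d d'"
    using L.amap_hom G.D.hom_Obj that by blast+
  moreover have "amap G z \<in> hom B (omap G c) (omap G c')" if "z \<in> hom A c c'"
    using G.amap_hom that .
  ultimately show ?thesis
    using counit_square_iff[of z c c' w]
    unfolding graph.sqS_def by (auto simp: S_graph_def id_functor_def)
qed

section \<open>The isomorphisms of categories\<close>

definition \<Phi> :: "('a \<times> 'c, 'b \<times> 'd, 'a, 'b) fctr" where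
  "\<Phi> = \<lparr>omap = fst, amap = fst\<rparr>"

definition \<Psi> :: "('a \<times> 'c, 'b \<times> 'd \<times> 'd, 'c, 'd) fctr" where
  "\<Psi> = \<lparr>omap = snd, amap = (\<lambda>f. fst (snd f))\<rparr>"

lemma Obj_graph:
  "p \<in> Obj graph.RR \<longleftrightarrow> (\<exists>a\<in>Obj A. p = (a, omap G a))"
  "p \<in> Obj graph.SS \<longleftrightarrow> (\<exists>b\<in>Obj B. p = (omap L b, b))"
  by (auto simp: R_tilde_def S_tilde_def R_graph_def S_graph_def)

lemma Arr_graph:
  "f \<in> Arr graph.RR \<longleftrightarrow> (\<exists>u\<in>Arr A. f = (u, amap G u))"
  "g \<in> Arr graph.SS \<longleftrightarrow> (\<exists>v\<in>Arr B. g = (amap L v, v, amap G (amap L v)))"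
  unfolding Arr_iff_hom graph.homR graph.homS sqR_graph_iff sqS_graph_iff
  by (auto simp: Arr_iff_hom, blast+)

lemma cat_isomorphism_\<Phi>: "cat_isomorphism graph.RR A \<Phi>"
proof -
  let ?F = "\<lparr>omap = (\<lambda>a. (a, omap G a)), amap = (\<lambda>u. (u, amap G u))\<rparr>"
  have "cat_functor graph.RR A \<Phi>"
  proof (intro cat_functor.intro cat_functor_axioms.intro graph.category_R_tilde G.C.category_axioms)
  qed (auto simp: Obj_graph graph.homR sqR_graph_iff \<Phi>_def, auto simp: R_tilde_def)
  moreover have "cat_functor A graph.RR ?F"
  proof (intro cat_functor.intro cat_functor_axioms.intro graph.category_R_tilde G.C.category_axioms)
  qed (auto simp: Obj_graph graph.homR sqR_graph_iff,
       auto simp: R_tilde_def G.amap_Id G.amap_Comp)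
  moreover have "functor_eq graph.RR (?F \<circ>\<^sub>F \<Phi>) id_functor"
    by (auto simp: functor_eq_id_iff Obj_graph Arr_graph comp_functor_def \<Phi>_def)
  moreover have "functor_eq A (\<Phi> \<circ>\<^sub>F ?F) id_functor"
    by (simp add: functor_eq_id_iff comp_functor_def \<Phi>_def)
  ultimately show ?thesis unfolding cat_isomorphism_def by blast
qed

lemma cat_isomorphism_\<Psi>: "cat_isomorphism graph.SS B \<Psi>"
proof -
  let ?F = "\<lparr>omap = (\<lambda>b. (omap L b, b)), amap = (\<lambda>v. (amap L v, v, amap G (amap L v)))\<rparr>"
  have "cat_functor graph.SS B \<Psi>"
  proof (intro cat_functor.intro cat_functor_axioms.intro graph.category_S_tilde G.D.category_axioms)
  qed (auto simp: Obj_graph graph.homS sqS_graph_iff \<Psi>_def, auto simp: S_tilde_def)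
  moreover have "cat_functor B graph.SS ?F"
  proof (intro cat_functor.intro cat_functor_axioms.intro graph.category_S_tilde G.D.category_axioms)
    fix f g a b c assume f: "f \<in> hom B a b" and g: "g \<in> hom B b c"
    then show "amap ?F (Comp B g f) = Comp graph.SS (amap ?F g) (amap ?F f)"
      using L.amap_Comp[OF f g] G.amap_Comp[OF L.amap_hom[OF f] L.amap_hom[OF g]]
      by (simp add: S_tilde_def)
  qed (auto simp: Obj_graph graph.homS sqS_graph_iff,
       auto simp: S_tilde_def L.amap_Id G.amap_Id L.omap_Obj)
  moreover have "functor_eq graph.SS (?F \<circ>\<^sub>F \<Psi>) id_functor"
    by (auto simp: functor_eq_id_iff Obj_graph Arr_graph comp_functor_def \<Psi>_def)
  moreover have "functor_eq B (\<Psi> \<circ>\<^sub>F ?F) id_functor"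
    by (simp add: functor_eq_id_iff comp_functor_def \<Psi>_def)
  ultimately show ?thesis unfolding cat_isomorphism_def by blast
qed

text \<open>
  The induced functor keeps the \<open>v\<close> component of an arrow, which is the one that \<open>\<Psi>\<close> reads off and
  which is \<open>G u\<close> for the arrows over \<open>R\<close>.
\<close>

lemma Z_tilde_graph: "functor_eq graph.RR (\<Psi> \<circ>\<^sub>F Z_tilde A B Zmap Wmap eps eta) (G \<circ>\<^sub>F \<Phi>)"
  by (auto simp: functor_eq_def Obj_graph Arr_graph comp_functor_def \<Psi>_def \<Phi>_def Z_tilde_def Let_def)

lemma W_tilde_graph: "functor_eq graph.SS (\<Phi> \<circ>\<^sub>F W_tilde Wmap) (L \<circ>\<^sub>F \<Psi>)"
  by (auto simp: functor_eq_def Obj_graph Arr_graph comp_functor_def \<Psi>_def \<Phi>_def W_tilde_def)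

end

theorem mainTheorem2:
  fixes A :: "('a, 'm) cat" and B :: "('b, 'n) cat"
    and G :: "('a, 'm, 'b, 'n) fctr" and L :: "('b, 'n, 'a, 'm) fctr"
    and \<eta> :: "'b \<Rightarrow> 'n" and \<epsilon> :: "'a \<Rightarrow> 'm"
  assumes "reflection A B G L \<eta> \<epsilon>"
  shows "\<exists>(U :: ('a, 'm) cat) I J R S \<xi> \<chi> Z W \<epsilon>' \<eta>' \<Phi> \<Psi>.
    relational_reflection_data A B U I J R S \<xi> \<chi> Z W \<epsilon>' \<eta>' \<and>
    cat_isomorphism (R_tilde A B U I J R \<xi>) A \<Phi> \<and>
    cat_isomorphism (S_tilde A B U I J S \<xi> \<chi> W) B \<Psi> \<and>
    functor_eq (R_tilde A B U I J R \<xi>) (\<Psi> \<circ>\<^sub>F Z_tilde A B Z W \<epsilon>' \<eta>') (G \<circ>\<^sub>F \<Phi>) \<and>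
    functor_eq (S_tilde A B U I J S \<xi> \<chi> W) (\<Phi> \<circ>\<^sub>F W_tilde W) (L \<circ>\<^sub>F \<Psi>)"
proof -
  interpret reflection A B G L \<eta> \<epsilon> by (fact assms)
  show ?thesis
    using graph_data cat_isomorphism_\<Phi> cat_isomorphism_\<Psi> Z_tilde_graph W_tilde_graph by blast
qed

end
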